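(* The mapping $P:\mathcal{HK}\to h^{\mathcal{HK}}$, $f\mapsto P[f]$, is an isometry into, but not onto, $h^{\mathcal{HK}}$; that is, $P[f]\in h^{\mathcal{HK}}$ and $\|P[f]\|_{\mathcal{HK}}=\|f\|$ for all $f\in\mathcal{HK}$, and there is $v\in h^{\mathcal{HK}}$ that is not of the form $P[f]$ for any $f\in\mathcal{HK}$.
   Context: $D$ is the open unit disc in $\mathbb{R}^2$; for $u:D\to\mathbb{R}$ write $u_r(\theta)=u(re^{i\theta})$. $\mathcal{HK}$ is the set of $2\pi$-periodic functions $f:\mathbb{R}\to\mathbb{R}$ that are Henstock--Kurzweil integrable over a period, equivalently with finite Alexiewicz norm $\|f\|:=\sup_I|\int_I f|$, the supremum being over intervals $I\subset\mathbb{R}$ of length at most $2\pi$; as a normed space its elements are identified when equal almost everywhere. The Poisson kernel is $\Phi_r(\theta)=\frac{1-r^2}{2\pi(1-2r\cos\theta+r^2)}$ and the Poisson integral of $f$ is $P[f](re^{i\theta})=\int_{-\pi}^{\pi}f(\phi)\Phi_r(\phi-\theta)\,d\phi$ (a Henstock--Kurzweil integral). $h^{\mathcal{HK}}:=\{u:D\to\mathbb{R}\mid \Delta u=0 \text{ in } D,\ \sup_{0\le r<1}\|u_r\|<\infty\}$, with norm $\|u\|_{\mathcal{HK}}:=\sup_{0\le r<1}\|u_r\|$, where $\|\cdot\|$ is the Alexiewicz norm. *)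

theory Defs
  imports "HOL-Analysis.Analysis"
begin

text \<open>
  The plane is modelled by the type of complex numbers, and the disc \<open>D\<close> is \<^term>\<open>ball 0 1 :: complex set\<close>.
  A function on \<open>D\<close> is a total function whose values outside \<open>D\<close> are irrelevant.
\<close>

text \<open>For \<open>v = 1\<close> and \<open>v = \<i>\<close> these are the partial derivatives in \<open>x\<close> and \<open>y\<close>.\<close>

definition partial_deriv :: "complex \<Rightarrow> (complex \<Rightarrow> real) \<Rightarrow> complex \<Rightarrow> real" where
  "partial_deriv v u z = deriv (\<lambda>t::real. u (z + of_real t * v)) 0"

definition C1_on :: "complex set \<Rightarrow> (complex \<Rightarrow> real) \<Rightarrow> bool" where
  "C1_on S u \<longleftrightarrow>
     (\<forall>v\<in>{1, \<i>}.
        (\<forall>z\<in>S. (\<lambda>t::real. u (z + of_real t * v)) field_differentiable at 0) \<and>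
        continuous_on S (partial_deriv v u))"

definition C2_on :: "complex set \<Rightarrow> (complex \<Rightarrow> real) \<Rightarrow> bool" where
  "C2_on S u \<longleftrightarrow> C1_on S u \<and> (\<forall>v\<in>{1, \<i>}. C1_on S (partial_deriv v u))"

definition laplacian :: "(complex \<Rightarrow> real) \<Rightarrow> complex \<Rightarrow> real" where
  "laplacian u z = partial_deriv 1 (partial_deriv 1 u) z + partial_deriv \<i> (partial_deriv \<i> u) z"

definition harmonic_on :: "complex set \<Rightarrow> (complex \<Rightarrow> real) \<Rightarrow> bool" where
  "harmonic_on S u \<longleftrightarrow> open S \<and> C2_on S u \<and> (\<forall>z\<in>S. laplacian u z = 0)"

text \<open>
  Below, \<^const>\<open>integral\<close> and \<^const>\<open>integrable_on\<close> are the Henstock--Kurzweil notions.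
  The suprema are taken in the extended reals, so that finiteness is a genuine condition.
\<close>

definition alexiewicz_norm :: "(real \<Rightarrow> real) \<Rightarrow> ereal" where
  "alexiewicz_norm f =
     (SUP I\<in>{I. is_interval I \<and> bounded I \<and> diameter I \<le> 2 * pi}. ereal \<bar>integral I f\<bar>)"

text \<open>
  Elements of \<open>HK\<close> are actual functions, that is, representatives of the classes modulo equality
  almost everywhere. The Alexiewicz norm and the Poisson integral depend only on the class.
\<close>

definition HK :: "(real \<Rightarrow> real) set" where
  "HK = {f. (\<forall>x. f (x + 2 * pi) = f x) \<and> f integrable_on {-pi..pi}}"

definition poisson_kernel :: "real \<Rightarrow> real \<Rightarrow> real" where
  "poisson_kernel r \<theta> = (1 - r\<^sup>2) / (2 * pi * (1 - 2 * r * cos \<theta> + r\<^sup>2))"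

text \<open>
  The kernel is \<open>2\<pi>\<close>-periodic and constant for \<open>r = 0\<close>, so the choice of argument of \<open>z\<close>
  does not matter.
\<close>

definition poisson_integral :: "(real \<Rightarrow> real) \<Rightarrow> complex \<Rightarrow> real" where
  "poisson_integral f z = integral {-pi..pi} (\<lambda>\<phi>. f \<phi> * poisson_kernel (cmod z) (\<phi> - Arg z))"

definition circle_fun :: "(complex \<Rightarrow> real) \<Rightarrow> real \<Rightarrow> real \<Rightarrow> real" where
  "circle_fun u r \<theta> = u (of_real r * cis \<theta>)"

definition hHK_norm :: "(complex \<Rightarrow> real) \<Rightarrow> ereal" where
  "hHK_norm u = (SUP r\<in>{0..<1}. alexiewicz_norm (circle_fun u r))"

definition hHK :: "(complex \<Rightarrow> real) set" where
  "hHK = {u. harmonic_on (ball 0 1) u \<and> hHK_norm u < \<infinity>}"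

end

theory Submission
  imports Defs "HOL-Complex_Analysis.Cauchy_Integral_Formula" "HOL-Library.Periodic_Fun"
begin

text \<open>
  Let \<open>F\<close> be a primitive of \<open>f\<close>; it is continuous, and \<open>F (x + 2 * pi) - F x\<close> is constant.
  Integrating by parts and using Fubini's theorem on continuous functions only, one finds that the
  integral of \<open>P[f]\<^sub>r\<close> over \<open>[\<alpha>, \<beta>]\<close> is the integral of
  \<open>(F (t + \<beta>) - F (t + \<alpha>)) * poisson_kernel r t\<close> over a period. The kernel is a probability
  density, so this is at most the Alexiewicz norm of \<open>f\<close>, and it is an approximate identity, so
  the integral tends to \<open>F \<beta> - F \<alpha>\<close> as \<open>r\<close> tends to \<open>1\<close>. Hence \<open>P\<close> is an isometry. The
  Poisson kernel itself comes from a point mass, whose primitive would be discontinuous.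
\<close>

subsection \<open>Primitives of Henstock--Kurzweil integrable functions\<close>

text \<open>Encoded by integrals over all compact intervals and not by a derivative, because the
  indefinite integral of a Henstock--Kurzweil integrable \<open>f\<close> need have derivative
  \<open>f\<close> only almost everywhere.\<close>

definition primitive_of :: "(real \<Rightarrow> real) \<Rightarrow> (real \<Rightarrow> real) \<Rightarrow> bool" where
  "primitive_of f F \<longleftrightarrow> (\<forall>a b. a \<le> b \<longrightarrow> (f has_integral (F b - F a)) {a..b})"

lemma primitive_ofD: "primitive_of f F \<Longrightarrow> a \<le> b \<Longrightarrow> (f has_integral (F b - F a)) {a..b}"
  by (simp add: primitive_of_def)

lemma primitive_of_integral: "primitive_of f F \<Longrightarrow> a \<le> b \<Longrightarrow> integral {a..b} f = F b - F a"
  by (simp add: primitive_ofD integral_unique)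

lemma primitive_of_antiderivative:
  assumes "\<And>x. (F has_real_derivative f x) (at x)"
  shows "primitive_of f F"
  unfolding primitive_of_def
proof (intro allI impI fundamental_theorem_of_calculus)
  show "(F has_vector_derivative f x) (at x within {a..b})" for a b x
    using has_field_derivative_at_within[OF assms]
    by (simp add: has_real_derivative_iff_has_vector_derivative[symmetric])
qed

text \<open>Indefinite Henstock--Kurzweil integrals are continuous even when \<open>f\<close> is
  unbounded or not absolutely integrable. The interval of radius 1 around \<open>x\<close> keeps
  \<open>x\<close> in the interior.\<close>

lemma primitive_of_continuous:
  assumes "primitive_of f F"
  shows "continuous_on S F"
proof -
  have "isCont F x" for x
  proof -
    have "continuous_on {x-1..x+1} (\<lambda>y. integral {x-1..y} f)"
      using primitive_ofD[OF assms, of "x-1" "x+1"]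
      by (intro indefinite_integral_continuous_1) auto
    then have "continuous_on {x-1..x+1} (\<lambda>y. integral {x-1..y} f + F (x-1))"
      by (intro continuous_intros)
    then have "continuous_on {x-1..x+1} F"
      by (rule continuous_on_eq) (use primitive_of_integral[OF assms] in auto)
    then show ?thesis
      by (auto intro: continuous_on_interior)
  qed
  then show ?thesis
    by (simp add: continuous_at_imp_continuous_on)
qed

lemma primitive_of_exists:
  assumes int: "\<And>a b. f integrable_on {a..b}"
  obtains F where "primitive_of f F"
proof -
  define F where "F x = (if x \<ge> 0 then integral {0..x} f else - integral {x..0} f)" for x
  \<comment> \<open>The three splittings correspond to \<open>0\<close> lying between
    \<open>a\<close> and \<open>b\<close>, to the left of both, and to the right of both.\<close>
  have "F b - F a = integral {a..b} f" if "a \<le> b" for a b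
    using that int Henstock_Kurzweil_Integration.integral_combine[where f = f and a = a and c = 0 and b = b]
      Henstock_Kurzweil_Integration.integral_combine[where f = f and a = 0 and c = a and b = b]
      Henstock_Kurzweil_Integration.integral_combine[where f = f and a = a and c = b and b = 0]
    by (auto simp: F_def)
  then have "primitive_of f F"
    unfolding primitive_of_def by (metis int integrable_integral)
  then show thesis by (rule that)
qed

lemma primitive_of_shift:
  assumes "primitive_of f F"
  shows "primitive_of (\<lambda>x. f (x + c)) (\<lambda>x. F (x + c))"
  unfolding primitive_of_def
proof (intro allI impI)
  fix a b :: real assume "a \<le> b"
  then show "((\<lambda>x. f (x + c)) has_integral F (b + c) - F (a + c)) {a..b}"
    using has_integral_shift_Icc_real[of f c "F (b + c) - F (a + c)" a b]
      primitive_ofD[OF assms, of "a + c" "b + c"]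
    by (simp add: o_def add.commute)
qed

text \<open>On a short interval \<open>[p, q]\<close> the second mean value theorem makes the defect in the formula
  equal to \<open>\<integral> (F x - F c) * g' x\<close> with \<open>c \<in> [p, q]\<close>; hence the defect, as a function of
  the upper limit, has derivative zero everywhere.\<close>

lemma has_integral_mult_monotone:
  assumes F: "primitive_of f F"
    and g: "\<And>x. (g has_real_derivative g' x) (at x)"
    and g'cont: "continuous_on UNIV g'"
    and g'pos: "\<And>x. x \<in> {a..b} \<Longrightarrow> g' x \<ge> 0"
    and "a \<le> b"
  shows "((\<lambda>x. f x * g x) has_integral
           (F b * g b - F a * g a - integral {a..b} (\<lambda>x. F x * g' x))) {a..b}"
proof -
  have contF: "continuous_on S F" for S by (rule primitive_of_continuous[OF F])
  have contg': "continuous_on S g'" for S using g'cont continuous_on_subset by blast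
  have mono: "g x \<le> g y" if "a \<le> x" "x \<le> y" "y \<le> b" for x y
    using DERIV_nonneg_imp_nondecreasing[of x y g] that g g'pos by (meson atLeastAtMost_iff order_trans)
  have intg': "(g' has_integral (g y - g x)) {x..y}" if "x \<le> y" for x y
    using primitive_ofD[OF primitive_of_antiderivative[OF g] that] .
  \<comment> \<open>This is where integrability of the product comes from: a product with a merely
    continuous function may fail to be integrable, but for monotone \<open>g\<close> the second mean
    value theorem supplies it.\<close>
  have smvt: "\<exists>c\<in>{p..q}. ((\<lambda>x. f x * g x) has_integral
      (F q * g q - F p * g p - F c * (g q - g p))) {p..q}" if "a \<le> p" "p \<le> q" "q \<le> b" for p q
  proof -
    have "f integrable_on {p..q}" using primitive_ofD[OF F \<open>p \<le> q\<close>] by blast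
    then obtain c where c: "c \<in> {p..q}"
      "((\<lambda>x. g x * f x) has_integral (g p * integral {p..c} f + g q * integral {c..q} f)) {p..q}"
    proof (rule second_mean_value_theorem_full[of f p q g])
      show "g x \<le> g y" if "p \<le> x" "x \<le> y" "y \<le> q" for x y
        using mono[of x y] that \<open>a \<le> p\<close> \<open>q \<le> b\<close> by simp
    qed (use \<open>p \<le> q\<close> in auto)
    moreover have "g p * integral {p..c} f + g q * integral {c..q} f
        = F q * g q - F p * g p - F c * (g q - g p)"
      using c(1) by (simp add: primitive_of_integral[OF F] algebra_simps)
    ultimately show ?thesis by (intro bexI[of _ c]) (simp_all add: mult.commute)
  qed
  \<comment> \<open>The defect up to a constant: \<open>H a = - F a * g a\<close>, so
    \<open>H b = H a\<close> is the claimed formula.\<close>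
  define H where "H x = integral {a..x} (\<lambda>x. f x * g x) - F x * g x
    + integral {a..x} (\<lambda>x. F x * g' x)" for x
  obtain M where M: "M > 0" "\<And>x. x \<in> {a..b} \<Longrightarrow> \<bar>g' x\<bar> \<le> M"
    using compact_imp_bounded[OF compact_continuous_image[OF contg' compact_Icc[of a b]]]
    by (auto simp: bounded_pos)
  have int1: "(\<lambda>x. f x * g x) integrable_on {p..q}" if "a \<le> p" "p \<le> q" "q \<le> b" for p q
    using smvt[OF that] by blast
  have int2: "(\<lambda>x. F x * g' x) integrable_on {p..q}" for p q
    by (intro integrable_continuous_interval continuous_intros contF contg')
  \<comment> \<open>The increment of \<open>H\<close> is the integral of
    \<open>(F x - F c) * g' x\<close>, hence at most oscillation of \<open>F\<close> times bound on
    \<open>g'\<close> times length.\<close>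
  have est: "\<bar>H q - H p\<bar> \<le> e * M * (q - p)"
    if pq: "a \<le> p" "p \<le> q" "q \<le> b" and e: "\<And>x y. x \<in> {p..q} \<Longrightarrow> y \<in> {p..q} \<Longrightarrow> \<bar>F x - F y\<bar> \<le> e"
    for p q e
  proof -
    obtain c where c: "c \<in> {p..q}" and I: "((\<lambda>x. f x * g x) has_integral
      (F q * g q - F p * g p - F c * (g q - g p))) {p..q}" using smvt[OF pq] by blast
    have "e \<ge> 0" using e[OF c c] by simp
    have "integral {a..q} (\<lambda>x. f x * g x) = integral {a..p} (\<lambda>x. f x * g x) + integral {p..q} (\<lambda>x. f x * g x)"
      using pq by (intro Henstock_Kurzweil_Integration.integral_combine[symmetric] int1) auto
    moreover have "integral {a..q} (\<lambda>x. F x * g' x) = integral {a..p} (\<lambda>x. F x * g' x) + integral {p..q} (\<lambda>x. F x * g' x)"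
      using pq by (intro Henstock_Kurzweil_Integration.integral_combine[symmetric] int2) auto
    ultimately have "H q - H p = integral {p..q} (\<lambda>x. F x * g' x) - F c * (g q - g p)"
      using integral_unique[OF I] by (simp add: H_def)
    moreover have "((\<lambda>x. F x * g' x - F c * g' x) has_integral
        (integral {p..q} (\<lambda>x. F x * g' x) - F c * (g q - g p))) {p..q}"
      using intg'[OF pq(2)] by (intro has_integral_diff integrable_integral int2 has_integral_mult_right)
    ultimately have "((\<lambda>x. F x * g' x - F c * g' x) has_integral (H q - H p)) (cbox p q)" by simp
    moreover have "norm (F x * g' x - F c * g' x) \<le> e * M" if "x \<in> cbox p q" for x
    proof -
      have "\<bar>F x - F c\<bar> * \<bar>g' x\<bar> \<le> e * M"
        using that c pq M \<open>e \<ge> 0\<close> by (intro mult_mono e) auto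
      then show ?thesis by (simp add: left_diff_distrib[symmetric] abs_mult)
    qed
    ultimately have "norm (H q - H p) \<le> e * M * measure lborel (cbox p q)"
      using \<open>e \<ge> 0\<close> M(1) by (intro has_integral_bound) auto
    then show ?thesis using pq by simp
  qed
  have "(H has_derivative (\<lambda>h. 0)) (at x within {a..b})" if x: "x \<in> {a..b}" for x
    unfolding has_derivative_within_alt
  proof (intro conjI allI impI)
    fix e :: real assume "e > 0"
    \<comment> \<open>Oscillation \<open>e / M\<close> of \<open>F\<close> makes the factor
      \<open>e * M\<close> in \<open>est\<close> equal to the required slope.\<close>
    then have "e / M > 0" using M by simp
    have "uniformly_continuous_on {a..b} F"
      by (intro compact_uniformly_continuous contF compact_Icc)
    then obtain d where d: "d > 0"
      "\<And>x y. x \<in> {a..b} \<Longrightarrow> y \<in> {a..b} \<Longrightarrow> dist y x < d \<Longrightarrow> dist (F y) (F x) < e / M"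
      by (rule uniformly_continuous_onE[OF _ \<open>e / M > 0\<close>]) metis
    have close: "\<bar>H q - H p\<bar> \<le> e * (q - p)" if "a \<le> p" "p \<le> q" "q \<le> b" "q - p < d" for p q
    proof -
      have "\<bar>F x - F y\<bar> \<le> e / M" if "x \<in> {p..q}" "y \<in> {p..q}" for x y
      proof -
        have "dist x y < d" using that \<open>q - p < d\<close> by (auto simp: dist_real_def)
        then have "dist (F x) (F y) < e / M"
          using d(2)[of y x] that \<open>a \<le> p\<close> \<open>q \<le> b\<close> by auto
        then show ?thesis by (simp add: dist_real_def)
      qed
      from est[OF that(1-3) this] show ?thesis using M(1) by simp
    qed
    show "\<exists>d>0. \<forall>y\<in>{a..b}. norm (y - x) < d \<longrightarrow> norm (H y - H x - 0) \<le> e * norm (y - x)"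
    proof (intro exI[of _ d] conjI ballI impI d(1))
      fix y assume "y \<in> {a..b}" "norm (y - x) < d"
      then show "norm (H y - H x - 0) \<le> e * norm (y - x)"
        using close[of x y] close[of y x] x by (cases "x \<le> y") (auto simp: abs_minus_commute)
    qed
  qed simp
  then obtain k where "\<And>x. x \<in> {a..b} \<Longrightarrow> H x = k"
    using has_derivative_zero_constant[of "{a..b}" H] by auto
  then have "H b = H a" using \<open>a \<le> b\<close> by auto
  then have "integral {a..b} (\<lambda>x. f x * g x) = F b * g b - F a * g a - integral {a..b} (\<lambda>x. F x * g' x)"
    by (simp add: H_def)
  then show ?thesis using int1[of a b] \<open>a \<le> b\<close> by (metis integrable_integral order_refl)
qed

text \<open>With \<open>M\<close> bounding the derivative of \<open>g\<close> on
  \<open>[a, b]\<close>, both \<open>g x + M * x\<close> and \<open>M * x\<close> are nondecreasing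
  there; the difference of the two monotone cases is the formula for \<open>g\<close>.\<close>

lemma has_integral_mult_C1:
  assumes F: "primitive_of f F"
    and g: "\<And>x. (g has_real_derivative g' x) (at x)"
    and g'cont: "continuous_on UNIV g'"
    and "a \<le> b"
  shows "((\<lambda>x. f x * g x) has_integral
           (F b * g b - F a * g a - integral {a..b} (\<lambda>x. F x * g' x))) {a..b}"
proof -
  have contF: "continuous_on S F" for S by (rule primitive_of_continuous[OF F])
  have contg': "continuous_on S g'" for S using g'cont continuous_on_subset by blast
  obtain M where M: "M > 0" "\<And>x. x \<in> {a..b} \<Longrightarrow> \<bar>g' x\<bar> \<le> M"
    using compact_imp_bounded[OF compact_continuous_image[OF contg' compact_Icc[of a b]]]
    by (auto simp: bounded_pos)
  have 1: "((\<lambda>x. f x * (g x + M * x)) has_integral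
           (F b * (g b + M * b) - F a * (g a + M * a) - integral {a..b} (\<lambda>x. F x * (g' x + M)))) {a..b}"
  proof (rule has_integral_mult_monotone[OF F])
    show "((\<lambda>x. g x + M * x) has_real_derivative g' x + M) (at x)" for x
      by (auto intro!: derivative_eq_intros g)
    show "g' x + M \<ge> 0" if "x \<in> {a..b}" for x using M(2)[OF that] by linarith
  qed (use \<open>a \<le> b\<close> in \<open>auto intro!: continuous_intros contg'\<close>)
  have 2: "((\<lambda>x. f x * (M * x)) has_integral
           (F b * (M * b) - F a * (M * a) - integral {a..b} (\<lambda>x. F x * M))) {a..b}"
    by (rule has_integral_mult_monotone[OF F]) (use \<open>a \<le> b\<close> M in \<open>auto intro!: derivative_eq_intros\<close>)
  have "integral {a..b} (\<lambda>x. F x * (g' x + M)) = integral {a..b} (\<lambda>x. F x * g' x) + integral {a..b} (\<lambda>x. F x * M)"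
    unfolding distrib_left
    by (intro integral_add integrable_continuous_interval continuous_intros contF contg')
  with has_integral_diff[OF 1 2] show ?thesis
    by (simp add: algebra_simps)
qed

section \<open>Periodic functions and their primitives\<close>

lemma periodic_integrable:
  fixes g :: "real \<Rightarrow> real"
  assumes per: "\<And>x. g (x + 2 * pi) = g x" and int: "g integrable_on {-pi..pi}"
  shows "g integrable_on {a..b}"
proof -
  have per': "g (x - 2 * pi) = g x" for x using per[of "x - 2 * pi"] by simp
  have shift: "g integrable_on {a + 2 * pi..b + 2 * pi}" "g integrable_on {a - 2 * pi..b - 2 * pi}"
    if "g integrable_on {a..b}" for a b
  proof -
    obtain I where "(g has_integral I) {a..b}" using \<open>g integrable_on {a..b}\<close> by blast
    moreover have "g \<circ> (+) (2 * pi) = g" "g \<circ> (+) (- (2 * pi)) = g"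
      using per per' by (auto simp: fun_eq_iff add.commute)
    ultimately show "g integrable_on {a + 2 * pi..b + 2 * pi}" "g integrable_on {a - 2 * pi..b - 2 * pi}"
      using has_integral_shift_Icc_real[of g "2 * pi" I a b] has_integral_shift_Icc_real[of g "- (2 * pi)" I a b]
      by auto
  qed
  have "g integrable_on {-pi - 2 * pi * real n..pi + 2 * pi * real n}" for n
  proof (induction n)
    case (Suc n)
    define R where "R = pi + 2 * pi * real n"
    \<comment> \<open>Since \<open>R\<close> is at least \<open>pi\<close>, the two translates of
      \<open>[-R, R]\<close> by \<open>2 * pi\<close> overlap or touch it, so the three together
      cover the next window.\<close>
    have R: "R \<ge> pi" "0 \<le> R" "- R \<le> R + 2 * pi" by (simp_all add: R_def add_nonneg_nonneg)
    have "g integrable_on {-R..R}" using Suc by (simp add: R_def)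
    note int = this shift[OF this]
    have "g integrable_on {-R - 2 * pi..-R}"
      by (rule integrable_subinterval_real[OF int(3)]) (use R in auto)
    moreover have "g integrable_on {-R..R + 2 * pi}"
    proof (rule Henstock_Kurzweil_Integration.integrable_combine[OF _ _ int(1)])
      show "g integrable_on {R..R + 2 * pi}"
        by (rule integrable_subinterval_real[OF int(2)]) (use R in auto)
    qed (use R in auto)
    ultimately have "g integrable_on {-R - 2 * pi..R + 2 * pi}"
      by (rule Henstock_Kurzweil_Integration.integrable_combine[rotated 2]) (use R in auto)
    then show ?case by (simp add: R_def algebra_simps)
  qed (use int in simp)
  note R = this
  obtain n where n: "\<bar>a\<bar> + \<bar>b\<bar> \<le> real n" using real_arch_simple by blast
  have "1 * real n \<le> (2 * pi) * real n"
    by (intro mult_right_mono) (use pi_gt3 in auto)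
  then have "-pi - 2 * pi * real n \<le> a" "b \<le> pi + 2 * pi * real n"
    using n pi_gt_zero by linarith+
  then show ?thesis
    by (intro integrable_subinterval_real[OF R[of n]]) auto
qed

text \<open>Translation by a period preserves the increments of \<open>F\<close>, so
  \<open>F (x + 2 * pi) - F x\<close> does not depend on \<open>x\<close>; its value is read off at
  \<open>x = -pi\<close>.\<close>

lemma periodic_primitive_quasiperiodic:
  assumes per: "\<And>x. f (x + 2 * pi) = f x" and F: "primitive_of f F"
  shows "F (x + 2 * pi) = F x + (F pi - F (-pi))"
proof -
  have 1: "F (y + 2 * pi) - F (x + 2 * pi) = F y - F x" if "x \<le> y" for x y
    using primitive_of_integral[OF primitive_of_shift[OF F, of "2 * pi"] that]
      primitive_of_integral[OF F that] per by simp
  show ?thesis using 1[of "-pi" x] 1[of x "-pi"] by (cases "-pi \<le> x") auto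
qed

text \<open>In terms of a primitive the left side is \<open>F (pi + t) - F (-pi + t)\<close>, which
  quasiperiodicity makes independent of \<open>t\<close>.\<close>

lemma periodic_integral:
  fixes g :: "real \<Rightarrow> real"
  assumes per: "\<And>x. g (x + 2 * pi) = g x" and int: "g integrable_on {-pi..pi}"
  shows "integral {-pi..pi} (\<lambda>x. g (x + t)) = integral {-pi..pi} g"
proof -
  obtain F where F: "primitive_of g F"
    using primitive_of_exists[of g] periodic_integrable[OF assms] by blast
  show ?thesis
    using periodic_primitive_quasiperiodic[OF per F, of "-pi + t"]
    by (simp add: primitive_of_integral[OF primitive_of_shift[OF F]] primitive_of_integral[OF F] algebra_simps)
qed

lemma HK_primitive:
  assumes "f \<in> HK"
  obtains F where "primitive_of f F" "\<And>x. F (x + 2 * pi) = F x + (F pi - F (-pi))"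
proof -
  obtain F where F: "primitive_of f F"
    using primitive_of_exists[of f] periodic_integrable[of f] assms unfolding HK_def by blast
  then show thesis
    using that periodic_primitive_quasiperiodic[OF _ F] assms unfolding HK_def by blast
qed

subsection \<open>The Poisson kernel\<close>

text \<open>For nonnegative \<open>r\<close> both summands are nonnegative. The first gives
  positivity for \<open>r < 1\<close>; the second gives the decay of the kernel away from
  \<open>t = 0\<close>.\<close>

lemma poisson_denominator: "1 - 2 * r * cos t + r\<^sup>2 = (1 - r)\<^sup>2 + 2 * r * (1 - cos (t::real))"
  by (simp add: power2_eq_square algebra_simps)

lemma poisson_denominator_pos:
  assumes "0 \<le> r" "r < (1::real)"
  shows "1 - 2 * r * cos t + r\<^sup>2 > 0"
proof -
  have "(1 - r)\<^sup>2 > 0" "2 * r * (1 - cos t) \<ge> 0" using assms by auto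
  then show ?thesis unfolding poisson_denominator by linarith
qed

lemma poisson_kernel_periodic [simp]: "poisson_kernel r (t + 2 * pi) = poisson_kernel r t"
  by (simp add: poisson_kernel_def)

lemma poisson_kernel_pos:
  assumes "0 \<le> r" "r < 1"
  shows "poisson_kernel r t > 0"
proof -
  have "r\<^sup>2 < 1" using assms by (simp add: power_less_one_iff)
  then show ?thesis
    unfolding poisson_kernel_def using poisson_denominator_pos[OF assms, of t] by simp
qed

definition poisson_kernel_deriv :: "real \<Rightarrow> real \<Rightarrow> real" where
  "poisson_kernel_deriv r t = - (1 - r\<^sup>2) * (2 * r * sin t) / (2 * pi * (1 - 2 * r * cos t + r\<^sup>2)\<^sup>2)"

lemma poisson_kernel_has_derivative:
  assumes "0 \<le> r" "r < 1"
  shows "(poisson_kernel r has_real_derivative poisson_kernel_deriv r t) (at t)"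
  using poisson_denominator_pos[OF assms, of t] pi_gt_zero
  unfolding poisson_kernel_def [abs_def] poisson_kernel_deriv_def
  by (auto intro!: derivative_eq_intros simp: divide_simps) (simp add: power2_eq_square algebra_simps)

lemma continuous_on_poisson_kernel_deriv:
  assumes "0 \<le> r" "r < 1"
  shows "continuous_on S (poisson_kernel_deriv r)"
  unfolding poisson_kernel_deriv_def [abs_def]
  using poisson_denominator_pos[OF assms] by (intro continuous_intros) (simp add: less_imp_neq[symmetric])

lemma continuous_on_poisson_kernel:
  assumes "0 \<le> r" "r < 1"
  shows "continuous_on S (poisson_kernel r)"
  using poisson_kernel_has_derivative[OF assms]
  by (meson DERIV_isCont continuous_at_imp_continuous_on)

text \<open>The denominator dominates \<open>2 * r * (1 - cos t)\<close>, against which the factor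
  \<open>1 - cos t\<close> cancels. The bound is uniform in \<open>t\<close> and vanishes as
  \<open>r\<close> tends to 1.\<close>

lemma poisson_kernel_bound:
  assumes "0 < r" "r < 1"
  shows "(1 - cos t) * poisson_kernel r t \<le> (1 - r\<^sup>2) / (4 * pi * r)"
proof -
  let ?d = "1 - 2 * r * cos t + r\<^sup>2"
  have d: "?d > 0" by (rule poisson_denominator_pos) (use assms in auto)
  have "r\<^sup>2 < 1" using assms by (simp add: power_less_one_iff)
  have "2 * r * (1 - cos t) \<le> ?d" unfolding poisson_denominator by simp
  then have "(1 - r\<^sup>2) * (2 * r * (1 - cos t)) \<le> (1 - r\<^sup>2) * ?d"
    using \<open>r\<^sup>2 < 1\<close> by (intro mult_left_mono) auto
  then show ?thesis
    using d assms unfolding poisson_kernel_def by (simp add: divide_simps) (simp add: algebra_simps)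
qed

text \<open>The conjugate series \<open>\<Sum>n. r ^ n * sin (n * t) / n\<close> sums to the arctangent term.\<close>

definition poisson_primitive :: "real \<Rightarrow> real \<Rightarrow> real" where
  "poisson_primitive r t = (t + 2 * arctan (r * sin t / (1 - r * cos t))) / (2 * pi)"

text \<open>Because \<open>1 - r * cos t\<close> is positive, the arctangent is smooth on the whole
  line. With \<open>d\<close> the kernel's denominator its derivative is
  \<open>(r * cos t - r\<^sup>2) / d\<close>, and adding twice this to 1 gives
  \<open>(1 - r\<^sup>2) / d\<close>.\<close>

lemma poisson_primitive_has_derivative:
  assumes "0 \<le> r" "r < 1"
  shows "(poisson_primitive r has_real_derivative poisson_kernel r t) (at t)"
proof -
  let ?d = "1 - 2 * r * cos t + r\<^sup>2"
  have "r * cos t \<le> r * 1" using assms by (intro mult_left_mono) auto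
  then have n: "1 - r * cos t > 0" using assms by linarith
  have d: "?d > 0" by (rule poisson_denominator_pos[OF assms])
  have sc: "sin t * sin t = 1 - cos t * cos t"
    using sin_cos_squared_add[of t] by (simp add: power2_eq_square)
  have e: "1 + (r * sin t / (1 - r * cos t))\<^sup>2 = ?d / (1 - r * cos t)\<^sup>2"
  proof -
    have "(1 - r * cos t)\<^sup>2 + (r * sin t)\<^sup>2 = ?d"
      by (simp add: power2_eq_square algebra_simps sc)
    then show ?thesis using n by (simp add: field_simps)
  qed
  have h: "((\<lambda>t. r * sin t / (1 - r * cos t)) has_real_derivative (r * cos t - r\<^sup>2) / (1 - r * cos t)\<^sup>2) (at t)"
    using n by (auto intro!: derivative_eq_intros simp: power2_eq_square) (simp add: algebra_simps sc)
  have "((\<lambda>t. arctan (r * sin t / (1 - r * cos t))) has_real_derivative (r * cos t - r\<^sup>2) / ?d) (at t)"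
    using DERIV_chain2[OF DERIV_arctan h] n d unfolding e by (simp add: divide_simps)
  then have "(poisson_primitive r has_real_derivative (1 + 2 * ((r * cos t - r\<^sup>2) / ?d)) / (2 * pi)) (at t)"
    unfolding poisson_primitive_def [abs_def]
    by (intro DERIV_cdivide DERIV_add DERIV_ident DERIV_cmult)
  moreover have "(1 + 2 * ((r * cos t - r\<^sup>2) / ?d)) / (2 * pi) = poisson_kernel r t"
    using d unfolding poisson_kernel_def by (simp add: field_simps)
  ultimately show ?thesis by simp
qed

lemma primitive_of_poisson_kernel:
  assumes "0 \<le> r" "r < 1"
  shows "primitive_of (poisson_kernel r) (poisson_primitive r)"
  by (intro primitive_of_antiderivative poisson_primitive_has_derivative assms)

text \<open>The arctangent term is periodic, so only the linear term contributes. The increment 1 is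
  the total mass of the kernel.\<close>

lemma poisson_primitive_shift: "poisson_primitive r (t + 2 * pi) = poisson_primitive r t + 1"
  by (simp add: poisson_primitive_def add_divide_distrib)

lemma has_integral_poisson_kernel:
  assumes "0 \<le> r" "r < 1"
  shows "(poisson_kernel r has_integral 1) {-pi..pi}"
  using primitive_ofD[OF primitive_of_poisson_kernel[OF assms], of "-pi" pi]
    poisson_primitive_shift[of r "-pi"] by simp

text \<open>Mollification bound: continuity of \<open>Q\<close> at \<open>0\<close> gives \<open>\<bar>Q t - Q 0\<bar> \<le> \<epsilon> + C * (1 - cos t)\<close>,
  and \<open>(1 - cos t) * poisson_kernel r t\<close> tends to \<open>0\<close> uniformly in \<open>t\<close>.\<close>

lemma poisson_kernel_approximate_identity:
  assumes Q: "continuous_on {-pi..pi} Q"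
  shows "((\<lambda>r. integral {-pi..pi} (\<lambda>t. Q t * poisson_kernel r t)) \<longlongrightarrow> Q 0) (at_left 1)"
proof (rule tendstoI)
  fix e :: real assume "e > 0"
  obtain d where d: "d > 0" "\<And>t. t \<in> {-pi..pi} \<Longrightarrow> \<bar>t\<bar> < d \<Longrightarrow> \<bar>Q t - Q 0\<bar> < e / 2"
    using Q[unfolded continuous_on_iff, rule_format, of 0 "e / 2"] \<open>e > 0\<close>
    by (auto simp: dist_real_def)
  obtain M where M: "M > 0" "\<And>t. t \<in> {-pi..pi} \<Longrightarrow> \<bar>Q t\<bar> \<le> M"
    using compact_imp_bounded[OF compact_continuous_image[OF Q compact_Icc]] by (auto simp: bounded_pos)
  \<comment> \<open>Capping at \<open>pi\<close> stays in the range where the cosine decreases, so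
    \<open>1 - cos t\<close> is at least \<open>1 - cos d'\<close> once \<open>\<bar>t\<bar>\<close>
    is at least \<open>d'\<close>.\<close>
  define d' where "d' = min d pi"
  have d': "0 < d'" "d' \<le> d" "d' \<le> pi" using d(1) by (auto simp: d'_def)
  have k: "1 - cos d' > 0" using cos_monotone_0_pi[of 0 d'] d' by simp
  \<comment> \<open>Chosen so that away from \<open>0\<close> the term
    \<open>C * (1 - cos t)\<close> already exceeds \<open>2 * M\<close>, the largest possible value
    of \<open>\<bar>Q t - Q 0\<bar>\<close>.\<close>
  define C where "C = 2 * M / (1 - cos d')"
  have C: "C > 0" using M k by (simp add: C_def)
  have bound: "\<bar>Q t - Q 0\<bar> \<le> e / 2 + C * (1 - cos t)" if t: "t \<in> {-pi..pi}" for t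
  proof (cases "\<bar>t\<bar> < d")
    case True
    moreover have "C * (1 - cos t) \<ge> 0" using C by simp
    ultimately show ?thesis using d(2)[OF t] by linarith
  next
    case False
    then have "cos \<bar>t\<bar> \<le> cos d'" using d' t by (intro cos_monotone_0_pi_le) auto
    then have "C * (1 - cos d') \<le> C * (1 - cos t)" using C by (intro mult_left_mono) auto
    moreover have "C * (1 - cos d') = 2 * M" using k by (simp add: C_def)
    ultimately show ?thesis using M(2)[OF t] M(2)[of 0] \<open>e > 0\<close> by auto
  qed
  have "((\<lambda>r. e / 2 + C * ((1 - r\<^sup>2) / (4 * pi * r)) * (2 * pi)) \<longlongrightarrow>
      e / 2 + C * ((1 - 1\<^sup>2) / (4 * pi * 1)) * (2 * pi)) (at_left (1::real))"
    by (intro tendsto_intros) auto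
  then have "\<forall>\<^sub>F r in at_left 1. e / 2 + C * ((1 - r\<^sup>2) / (4 * pi * r)) * (2 * pi) < e"
    by (rule order_tendstoD) (use \<open>e > 0\<close> in auto)
  moreover have "\<forall>\<^sub>F r in at_left 1. r \<in> {0<..<1::real}"
    by (rule eventually_at_leftI[of 0]) auto
  ultimately show "\<forall>\<^sub>F r in at_left 1. dist (integral {-pi..pi} (\<lambda>t. Q t * poisson_kernel r t)) (Q 0) < e"
  proof eventually_elim
    case (elim r)
    then have r: "0 \<le> r" "r < 1" "0 < r" by auto
    note K = has_integral_poisson_kernel[OF r(1,2)]
    let ?c = "C * ((1 - r\<^sup>2) / (4 * pi * r))"
    have "(\<lambda>t. Q t * poisson_kernel r t) integrable_on {-pi..pi}"
      by (intro integrable_continuous_interval continuous_intros Q continuous_on_poisson_kernel r)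
    then have 1: "((\<lambda>t. Q t * poisson_kernel r t - Q 0 * poisson_kernel r t) has_integral
        (integral {-pi..pi} (\<lambda>t. Q t * poisson_kernel r t) - Q 0 * 1)) {-pi..pi}"
      by (intro has_integral_diff has_integral_mult_right K integrable_integral)
    \<comment> \<open>The majorant integrates exactly: the kernel has mass 1 and the constant
      \<open>?c\<close> is spread over length \<open>2 * pi\<close>.\<close>
    have 2: "((\<lambda>t. e / 2 * poisson_kernel r t + ?c) has_integral (e / 2 * 1 + ?c * (2 * pi))) {-pi..pi}"
      using has_integral_const_real[of ?c "-pi" pi]
      by (intro has_integral_add has_integral_mult_right K) (simp add: mult.commute)
    have "norm (Q t * poisson_kernel r t - Q 0 * poisson_kernel r t) \<le> e / 2 * poisson_kernel r t + ?c"
      if "t \<in> {-pi..pi}" for t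
    proof -
      have p: "poisson_kernel r t > 0" by (rule poisson_kernel_pos[OF r(1,2)])
      have "norm (Q t * poisson_kernel r t - Q 0 * poisson_kernel r t) = \<bar>Q t - Q 0\<bar> * poisson_kernel r t"
        using p by (simp add: left_diff_distrib[symmetric] abs_mult)
      also have "\<dots> \<le> (e / 2 + C * (1 - cos t)) * poisson_kernel r t"
        using p bound[OF that] by (intro mult_right_mono) auto
      also have "\<dots> = e / 2 * poisson_kernel r t + C * ((1 - cos t) * poisson_kernel r t)"
        by (simp add: algebra_simps)
      also have "\<dots> \<le> e / 2 * poisson_kernel r t + ?c"
        using C poisson_kernel_bound[OF r(3,2), of t] by (intro add_left_mono mult_left_mono) auto
      finally show ?thesis .
    qed
    then have "norm (integral {-pi..pi} (\<lambda>t. Q t * poisson_kernel r t) - Q 0 * 1) \<le> e / 2 * 1 + ?c * (2 * pi)"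
      using integral_norm_bound_integral[OF has_integral_integrable[OF 1] has_integral_integrable[OF 2]]
      unfolding integral_unique[OF 1] integral_unique[OF 2] by blast
    then show ?case using elim by (simp add: dist_real_def)
  qed
qed

subsection \<open>Real parts of holomorphic functions\<close>

lemma Re_holomorphic_has_partial_derivative:
  assumes "open S" and W: "W holomorphic_on S" and u: "\<And>z. z \<in> S \<Longrightarrow> u z = Re (W z)" and "z \<in> S"
  shows "((\<lambda>t. u (z + of_real t * v)) has_real_derivative Re (v * deriv W z)) (at 0)"
proof -
  let ?l = "\<lambda>t::real. z + of_real t * v"
  have l: "(?l has_vector_derivative v) (at 0)"
    unfolding has_vector_derivative_def
    by (auto intro!: derivative_eq_intros simp: scaleR_conv_of_real)
  have "(W has_field_derivative deriv W z) (at (?l 0))"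
    using holomorphic_derivI[OF W \<open>open S\<close> \<open>z \<in> S\<close>] by simp
  from field_vector_diff_chain_at[OF l this]
  have "((\<lambda>t. Re (W (?l t))) has_real_derivative Re (v * deriv W z)) (at 0)"
    by (intro has_field_derivative_Re) (simp add: o_def)
  \<comment> \<open>\<open>u\<close> agrees with the real part of \<open>W\<close> only on
    \<open>S\<close>, which still covers all small \<open>t\<close>.\<close>
  moreover have "open (?l -` S)"
    by (intro open_vimage \<open>open S\<close> continuous_intros)
  ultimately show ?thesis
    by (rule has_field_derivative_transform_within_open) (use \<open>z \<in> S\<close> u in auto)
qed

lemma partial_deriv_Re_holomorphic:
  assumes "open S" "W holomorphic_on S" "\<And>z. z \<in> S \<Longrightarrow> u z = Re (W z)" "z \<in> S"
  shows "partial_deriv v u z = Re (v * deriv W z)"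
  unfolding partial_deriv_def by (rule DERIV_imp_deriv[OF Re_holomorphic_has_partial_derivative[OF assms]])

lemma C1_on_Re_holomorphic:
  assumes "open S" and W: "W holomorphic_on S" and u: "\<And>z. z \<in> S \<Longrightarrow> u z = Re (W z)"
  shows "C1_on S u"
proof -
  have "continuous_on S (deriv W)"
    by (intro holomorphic_on_imp_continuous_on holomorphic_deriv W \<open>open S\<close>)
  then have "continuous_on S (\<lambda>z. Re (v * deriv W z))" for v
    by (intro continuous_intros)
  then have "continuous_on S (partial_deriv v u)" for v
    by (rule continuous_on_eq) (simp add: partial_deriv_Re_holomorphic[OF assms])
  then show ?thesis
    unfolding C1_on_def field_differentiable_def
    using Re_holomorphic_has_partial_derivative[OF assms] by blast
qed

text \<open>The derivative of \<open>u\<close> in direction \<open>v\<close> is the real part of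
  \<open>v * deriv W z\<close>, again holomorphic, so the first-order lemma iterates. Second
  derivatives carry the factor \<open>v * v\<close>, and the factors for \<open>1\<close> and
  \<open>\<i>\<close> are \<open>1\<close> and \<open>-1\<close>.\<close>

lemma harmonic_on_Re_holomorphic:
  assumes "open S" and W: "W holomorphic_on S" and u: "\<And>z. z \<in> S \<Longrightarrow> u z = Re (W z)"
  shows "harmonic_on S u"
proof -
  have W': "(\<lambda>z. v * deriv W z) holomorphic_on S" for v
    by (intro holomorphic_intros holomorphic_deriv W \<open>open S\<close>)
  have u': "partial_deriv v u z = Re (v * deriv W z)" if "z \<in> S" for v z
    by (rule partial_deriv_Re_holomorphic[OF assms that])
  have "C1_on S (partial_deriv v u)" for v
    by (rule C1_on_Re_holomorphic[OF \<open>open S\<close> W' u'])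
  moreover have "partial_deriv v (partial_deriv v u) z = Re (v * v * deriv (deriv W) z)"
    if "z \<in> S" for v z
  proof -
    have "deriv (\<lambda>z. v * deriv W z) z = v * deriv (deriv W) z"
      by (intro deriv_cmult holomorphic_on_imp_differentiable_at[OF _ \<open>open S\<close> that]
          holomorphic_deriv W \<open>open S\<close>)
    then show ?thesis
      using partial_deriv_Re_holomorphic[OF \<open>open S\<close> W' u' that] by (simp add: mult.assoc)
  qed
  ultimately show ?thesis
    unfolding harmonic_on_def C2_on_def laplacian_def
    using C1_on_Re_holomorphic[OF assms] \<open>open S\<close> by simp
qed

subsection \<open>Harmonicity of Poisson integrals\<close>

text \<open>The quotient is the Herglotz kernel. For \<open>z = rcis r t\<close> its real part is
  \<open>1 - r\<^sup>2\<close> over the squared distance from \<open>z\<close> to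
  \<open>cis \<phi>\<close>.\<close>

lemma poisson_kernel_eq_Re:
  assumes "0 \<le> r" "r < 1"
  shows "poisson_kernel r (\<phi> - t) = Re ((cis \<phi> + rcis r t) / (cis \<phi> - rcis r t)) / (2 * pi)"
proof -
  have sc: "sin x * sin x = 1 - cos x * cos x" for x :: real
    using sin_cos_squared_add[of x] by (simp add: power2_eq_square)
  have "Re ((cis \<phi> + rcis r t) / (cis \<phi> - rcis r t)) = (1 - r\<^sup>2) / (1 - 2 * r * cos (\<phi> - t) + r\<^sup>2)"
    unfolding Re_divide
    by (rule arg_cong2[where f = "(/)"])
      (simp_all add: rcis_def power2_eq_square cos_diff algebra_simps sc)
  then show ?thesis by (simp add: poisson_kernel_def mult.commute)
qed

text \<open>Trades the discontinuous \<open>Arg\<close> for an expression holomorphic in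
  \<open>z\<close>.\<close>

lemma poisson_kernel_cmod_Arg:
  assumes "z \<in> ball 0 1"
  shows "poisson_kernel (cmod z) (\<phi> - Arg z) = Re ((cis \<phi> + z) / (cis \<phi> - z)) / (2 * pi)"
  using poisson_kernel_eq_Re[of "cmod z" \<phi> "Arg z"] assms by (simp add: rcis_cmod_Arg)

lemma circle_fun_poisson_integral:
  assumes "0 \<le> r" "r < 1"
  shows "circle_fun (poisson_integral f) r \<theta> = integral {-pi..pi} (\<lambda>\<phi>. f \<phi> * poisson_kernel r (\<phi> - \<theta>))"
proof -
  have "cmod (rcis r \<theta>) = r" using assms by simp
  \<comment> \<open>\<open>Arg (rcis r \<theta>)\<close> may differ from \<open>\<theta>\<close> by
    a multiple of \<open>2 * pi\<close>, and is unrelated to it at \<open>r = 0\<close>; both sides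
    are compared through the Herglotz kernel.\<close>
  moreover from this have "poisson_kernel r (\<phi> - Arg (rcis r \<theta>)) = poisson_kernel r (\<phi> - \<theta>)" for \<phi>
    using poisson_kernel_cmod_Arg[of "rcis r \<theta>" \<phi>] poisson_kernel_eq_Re[OF assms, of \<phi> \<theta>] assms by simp
  ultimately show ?thesis
    unfolding circle_fun_def poisson_integral_def rcis_def[symmetric] by simp
qed

lemma cis_neq_ball: "z \<in> ball 0 1 \<Longrightarrow> cis \<phi> \<noteq> z"
  by (metis dist_0_norm less_irrefl mem_ball norm_cis)

text \<open>Integration by parts moves the derivative onto the kernel, so that only the continuous
  primitive \<open>F\<close> of \<open>f\<close> remains under the integral sign.\<close>

lemma harmonic_on_poisson_integral:
  assumes "f \<in> HK"
  shows "harmonic_on (ball 0 1) (poisson_integral f)"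
proof -
  obtain F where F: "primitive_of f F" using HK_primitive[OF assms] by blast
  have contF: "continuous_on S F" for S by (rule primitive_of_continuous[OF F])
  define K where "K \<phi> z = (cis \<phi> + z) / (cis \<phi> - z)" for \<phi> z
  \<comment> \<open>The derivative of the Herglotz kernel \<open>K\<close> in the angle
    \<open>\<phi>\<close>, not in \<open>z\<close>.\<close>
  define K' where "K' \<phi> z = - 2 * \<i> * z * cis \<phi> / (cis \<phi> - z)\<^sup>2" for \<phi> z
  \<comment> \<open>The right side of integration by parts with the complex kernel in place of its
    real part.\<close>
  define W where "W z = (of_real (F pi) * K pi z - of_real (F (-pi)) * K (-pi) z
      - integral (cbox (-pi) pi) (\<lambda>\<phi>. of_real (F \<phi>) * K' \<phi> z)) / (2 * pi)" for z
  have K': "((\<lambda>\<phi>. Re (K \<phi> z) / (2 * pi)) has_real_derivative Re (K' \<phi> z) / (2 * pi)) (at \<phi>)"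
    if "z \<in> ball 0 1" for z \<phi>
  proof -
    have 1: "(cis has_vector_derivative \<i> * cis \<phi>) (at \<phi>)"
      unfolding has_vector_derivative_def by (auto intro!: derivative_eq_intros)
    have 2: "((\<lambda>w. (w + z) / (w - z)) has_field_derivative (- 2 * z / (cis \<phi> - z)\<^sup>2)) (at (cis \<phi>))"
      using cis_neq_ball[OF that, of \<phi>]
      by (auto intro!: derivative_eq_intros simp: power2_eq_square)
    have "((\<lambda>\<phi>. K \<phi> z) has_vector_derivative K' \<phi> z) (at \<phi>)"
      using field_vector_diff_chain_at[OF 1 2] by (simp add: o_def K_def K'_def mult_ac)
    then show ?thesis by (intro DERIV_cdivide has_field_derivative_Re)
  qed
  have contK': "continuous_on S (\<lambda>\<phi>. K' \<phi> z)" if "z \<in> ball 0 1" for z S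
    unfolding K'_def using cis_neq_ball[OF that] by (intro continuous_intros) auto
  have int: "(\<lambda>\<phi>. of_real (F \<phi>) * K' \<phi> z) integrable_on cbox (-pi) pi" if "z \<in> ball 0 1" for z
    by (intro integrable_continuous continuous_intros contF contK' that)
  have "poisson_integral f z = Re (W z)" if z: "z \<in> ball 0 1" for z
  proof -
    have "poisson_integral f z = integral {-pi..pi} (\<lambda>\<phi>. f \<phi> * (Re (K \<phi> z) / (2 * pi)))"
      unfolding poisson_integral_def poisson_kernel_cmod_Arg[OF z] K_def ..
    also have "\<dots> = F pi * (Re (K pi z) / (2 * pi)) - F (-pi) * (Re (K (-pi) z) / (2 * pi))
        - integral {-pi..pi} (\<lambda>\<phi>. F \<phi> * (Re (K' \<phi> z) / (2 * pi)))"
      by (intro integral_unique has_integral_mult_C1[OF F] K' z continuous_intros contK') auto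
    also have "integral {-pi..pi} (\<lambda>\<phi>. F \<phi> * (Re (K' \<phi> z) / (2 * pi)))
        = integral (cbox (-pi) pi) (\<lambda>\<phi>. Re (of_real (F \<phi>) * K' \<phi> z)) / (2 * pi)"
      by simp
    also have "integral (cbox (-pi) pi) (\<lambda>\<phi>. Re (of_real (F \<phi>) * K' \<phi> z))
        = Re (integral (cbox (-pi) pi) (\<lambda>\<phi>. of_real (F \<phi>) * K' \<phi> z))"
      using integral_linear[OF int[OF z] bounded_linear_Re] by (simp add: o_def)
    finally show ?thesis by (simp add: W_def diff_divide_distrib)
  qed
  moreover have "W holomorphic_on ball 0 1"
  proof -
    \<comment> \<open>Differentiation under the integral sign: the integrand has a
      \<open>z\<close>-derivative that is jointly continuous in \<open>z\<close> and
      \<open>\<phi>\<close>, thanks to continuity of \<open>F\<close>.\<close>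
    have "(\<lambda>z. integral (cbox (-pi) pi) (\<lambda>\<phi>. of_real (F \<phi>) * K' \<phi> z)) holomorphic_on ball 0 1"
    proof (rule leibniz_rule_holomorphic)
      fix z \<phi> assume "z \<in> ball (0::complex) 1" "\<phi> \<in> cbox (-pi) pi"
      then show "((\<lambda>z. of_real (F \<phi>) * K' \<phi> z) has_field_derivative
          of_real (F \<phi>) * (- 2 * \<i> * cis \<phi> * (cis \<phi> + z) / (cis \<phi> - z) ^ 3)) (at z within ball 0 1)"
        unfolding K'_def using cis_neq_ball[of z \<phi>]
        by (auto intro!: derivative_eq_intros simp: divide_simps power2_eq_square power3_eq_cube)
           (simp_all add: algebra_simps)?
    next
      have "continuous_on (ball 0 1 \<times> cbox (-pi) pi) (\<lambda>p. of_real (F (snd p)) *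
          (- 2 * \<i> * cis (snd p) * (cis (snd p) + fst p) / (cis (snd p) - fst p) ^ 3))"
        by (intro continuous_intros continuous_on_compose2[OF contF[of UNIV] continuous_on_snd])
           (use cis_neq_ball in auto)
      then show "continuous_on (ball 0 1 \<times> cbox (-pi) pi) (\<lambda>(z, \<phi>). of_real (F \<phi>) *
          (- 2 * \<i> * cis \<phi> * (cis \<phi> + z) / (cis \<phi> - z) ^ 3))"
        by (simp add: case_prod_unfold)
    qed (use int in auto)
    then show ?thesis
      unfolding W_def [abs_def] K_def
      by (intro holomorphic_intros) (use cis_neq_ball in auto)
  qed
  ultimately show ?thesis by (intro harmonic_on_Re_holomorphic) auto
qed

subsection \<open>The Alexiewicz norm on circles\<close>

text \<open>Integration by parts replaces \<open>f\<close> by the continuous \<open>F\<close>, the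
  order of integration is swapped, and a second integration by parts, read backwards, takes the
  derivative off the kernel again. Quasiperiodicity makes the boundary terms match.\<close>

lemma integral_circle_fun_poisson_integral:
  assumes f: "f \<in> HK" and F: "primitive_of f F"
    and per: "\<And>x. F (x + 2 * pi) = F x + (F pi - F (-pi))"
    and r: "0 \<le> r" "r < 1" and "\<alpha> \<le> \<beta>"
  shows "integral {\<alpha>..\<beta>} (circle_fun (poisson_integral f) r) =
    integral {-pi..pi} (\<lambda>\<phi>. (F (\<phi> + \<beta>) - F (\<phi> + \<alpha>)) * poisson_kernel r \<phi>)"
proof -
  define c where "c = F pi - F (-pi)"
  define k where "k = poisson_kernel r pi"
  define \<Phi>' where "\<Phi>' = poisson_kernel_deriv r"
  have contF: "continuous_on S F" for S by (rule primitive_of_continuous[OF F])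
  have cont': "continuous_on S \<Phi>'" for S
    unfolding \<Phi>'_def by (rule continuous_on_poisson_kernel_deriv[OF r])
  have k': "poisson_kernel r (-pi) = k"
    using poisson_kernel_periodic[of r "-pi"] by (simp add: k_def)
  have fper: "f (x + 2 * pi) = f x" for x using f by (simp add: HK_def)
  \<comment> \<open>Translating by \<open>\<theta>\<close> moves the parameter from the kernel to
    \<open>F\<close>. The boundary term is the constant \<open>c * k\<close>, spread evenly over the
    period so that everything stands under one integral.\<close>
  have circle: "circle_fun (poisson_integral f) r \<theta> =
      integral {-pi..pi} (\<lambda>\<phi>. c * k / (2 * pi) - F (\<phi> + \<theta>) * \<Phi>' \<phi>)" for \<theta>
  proof -
    have "((\<lambda>\<phi>. poisson_kernel r (\<phi> - \<theta>)) has_real_derivative \<Phi>' (\<phi> - \<theta>)) (at \<phi>)" for \<phi>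
      unfolding \<Phi>'_def using poisson_kernel_has_derivative[OF r, of "\<phi> + - \<theta>"]
      unfolding DERIV_shift by simp
    moreover have "continuous_on UNIV (\<lambda>\<phi>. \<Phi>' (\<phi> - \<theta>))"
      by (rule continuous_on_compose2[OF cont'[of UNIV]]) (auto intro!: continuous_intros)
    ultimately have "(\<lambda>\<phi>. f \<phi> * poisson_kernel r (\<phi> - \<theta>)) integrable_on {-pi..pi}"
      by (intro has_integral_integrable[OF has_integral_mult_C1[OF F]]) auto
    then have "circle_fun (poisson_integral f) r \<theta> =
        integral {-pi..pi} (\<lambda>\<phi>. f (\<phi> + \<theta>) * poisson_kernel r (\<phi> + \<theta> - \<theta>))"
      unfolding circle_fun_poisson_integral[OF r]
      by (intro periodic_integral[symmetric])
        (use fper poisson_kernel_periodic[of r "_ - \<theta>"] in \<open>simp_all add: algebra_simps\<close>)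
    also have "\<dots> = integral {-pi..pi} (\<lambda>\<phi>. f (\<phi> + \<theta>) * poisson_kernel r \<phi>)" by simp
    also have "\<dots> = F (pi + \<theta>) * poisson_kernel r pi - F (-pi + \<theta>) * poisson_kernel r (-pi)
        - integral {-pi..pi} (\<lambda>\<phi>. F (\<phi> + \<theta>) * \<Phi>' \<phi>)"
      by (intro integral_unique has_integral_mult_C1[OF primitive_of_shift[OF F]] cont')
        (auto simp: \<Phi>'_def intro: poisson_kernel_has_derivative[OF r])
    also have "\<dots> = c * k - integral {-pi..pi} (\<lambda>\<phi>. F (\<phi> + \<theta>) * \<Phi>' \<phi>)"
    proof -
      have "F (pi + \<theta>) = F (-pi + \<theta>) + c"
        using per[of "-pi + \<theta>"] by (simp add: c_def add.commute)
      then show ?thesis unfolding k' by (simp add: k_def algebra_simps)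
    qed
    also have "\<dots> = integral {-pi..pi} (\<lambda>\<phi>. c * k / (2 * pi) - F (\<phi> + \<theta>) * \<Phi>' \<phi>)"
      by (subst integral_diff)
        (auto intro!: integrable_continuous_interval continuous_intros continuous_on_compose2[OF contF[of UNIV]] cont')
    finally show ?thesis .
  qed
  obtain E where E: "primitive_of F E"
    using primitive_of_exists[of F] integrable_continuous_interval[OF contF] by blast
  \<comment> \<open>\<open>G \<phi>\<close> is the integral of \<open>F (\<phi> + \<theta>)\<close>
    over \<open>\<theta>\<close> in \<open>[\<alpha>, \<beta>]\<close>, the inner integral after the
    swap.\<close>
  define G where "G \<phi> = E (\<phi> + \<beta>) - E (\<phi> + \<alpha>)" for \<phi>
  have G: "primitive_of (\<lambda>\<phi>. F (\<phi> + \<beta>) - F (\<phi> + \<alpha>)) G"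
    unfolding primitive_of_def G_def
    using has_integral_diff[OF primitive_ofD[OF primitive_of_shift[OF E, of \<beta>]]
        primitive_ofD[OF primitive_of_shift[OF E, of \<alpha>]]]
    by (simp add: algebra_simps)
  have Gper: "G pi - G (-pi) = c * (\<beta> - \<alpha>)"
  proof -
    have "((\<lambda>x. F (x + pi) - F (x + - pi)) has_integral
        (E (\<beta> + pi) - E (\<alpha> + pi)) - (E (\<beta> + - pi) - E (\<alpha> + - pi))) {\<alpha>..\<beta>}"
      by (intro has_integral_diff primitive_ofD primitive_of_shift E \<open>\<alpha> \<le> \<beta>\<close>)
    moreover have "F (x + pi) - F (x + - pi) = c" for x
      using per[of "x - pi"] by (simp add: c_def add.commute)
    moreover have "(E (\<beta> + pi) - E (\<alpha> + pi)) - (E (\<beta> + - pi) - E (\<alpha> + - pi)) = G pi - G (-pi)"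
      by (simp add: G_def add.commute)
    ultimately have "((\<lambda>x. c) has_integral G pi - G (-pi)) {\<alpha>..\<beta>}" by simp
    moreover have "((\<lambda>x. c) has_integral (\<beta> - \<alpha>) *\<^sub>R c) {\<alpha>..\<beta>}"
      using has_integral_const_real[of c \<alpha> \<beta>] \<open>\<alpha> \<le> \<beta>\<close> by simp
    ultimately have "G pi - G (-pi) = (\<beta> - \<alpha>) *\<^sub>R c" by (rule has_integral_unique)
    then show ?thesis by simp
  qed
  have inner: "integral {\<alpha>..\<beta>} (\<lambda>\<theta>. c * k / (2 * pi) - F (\<phi> + \<theta>) * \<Phi>' \<phi>)
      = c * k * (\<beta> - \<alpha>) / (2 * pi) - G \<phi> * \<Phi>' \<phi>" for \<phi>
  proof (rule integral_unique)
    have "((\<lambda>\<theta>. F (\<theta> + \<phi>)) has_integral G \<phi>) {\<alpha>..\<beta>}"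
      using primitive_ofD[OF primitive_of_shift[OF E, of \<phi>] \<open>\<alpha> \<le> \<beta>\<close>] by (simp add: G_def add.commute)
    then have "((\<lambda>\<theta>. c * k / (2 * pi) - F (\<theta> + \<phi>) * \<Phi>' \<phi>) has_integral
        (\<beta> - \<alpha>) *\<^sub>R (c * k / (2 * pi)) - G \<phi> * \<Phi>' \<phi>) {\<alpha>..\<beta>}"
      using has_integral_const_real[of "c * k / (2 * pi)" \<alpha> \<beta>] \<open>\<alpha> \<le> \<beta>\<close>
      by (intro has_integral_diff has_integral_mult_left) simp_all
    then show "((\<lambda>\<theta>. c * k / (2 * pi) - F (\<phi> + \<theta>) * \<Phi>' \<phi>) has_integral
        c * k * (\<beta> - \<alpha>) / (2 * pi) - G \<phi> * \<Phi>' \<phi>) {\<alpha>..\<beta>}"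
      by (simp only: add.commute[of \<phi>] real_scaleR_def times_divide_eq_right mult.commute[of "\<beta> - \<alpha>"])
  qed
  have "integral {\<alpha>..\<beta>} (circle_fun (poisson_integral f) r)
      = integral (cbox \<alpha> \<beta>) (\<lambda>\<theta>. integral (cbox (-pi) pi) (\<lambda>\<phi>. c * k / (2 * pi) - F (\<phi> + \<theta>) * \<Phi>' \<phi>))"
    unfolding ext[OF circle] by simp
  also have "\<dots> = integral (cbox (-pi) pi) (\<lambda>\<phi>. integral (cbox \<alpha> \<beta>) (\<lambda>\<theta>. c * k / (2 * pi) - F (\<phi> + \<theta>) * \<Phi>' \<phi>))"
    by (rule integral_swap_continuous)
      (auto simp: case_prod_unfold intro!: continuous_intros continuous_on_compose2[OF contF[of UNIV]]
        continuous_on_compose2[OF cont'[of UNIV]])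
  also have "\<dots> = integral {-pi..pi} (\<lambda>\<phi>. c * k * (\<beta> - \<alpha>) / (2 * pi) - G \<phi> * \<Phi>' \<phi>)"
    using inner by simp
  also have "\<dots> = c * k * (\<beta> - \<alpha>) - integral {-pi..pi} (\<lambda>\<phi>. G \<phi> * \<Phi>' \<phi>)"
    by (subst integral_diff)
      (auto intro!: integrable_continuous_interval continuous_intros primitive_of_continuous[OF G] cont')
  \<comment> \<open>By \<open>Gper\<close> the constant is exactly the boundary term for the
    primitive \<open>G\<close>.\<close>
  also have "\<dots> = G pi * poisson_kernel r pi - G (-pi) * poisson_kernel r (-pi)
      - integral {-pi..pi} (\<lambda>\<phi>. G \<phi> * \<Phi>' \<phi>)"
  proof -
    have "c * k * (\<beta> - \<alpha>) = (G pi - G (-pi)) * k" unfolding Gper by simp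
    then show ?thesis unfolding k' by (simp add: k_def left_diff_distrib)
  qed
  also have "\<dots> = integral {-pi..pi} (\<lambda>\<phi>. (F (\<phi> + \<beta>) - F (\<phi> + \<alpha>)) * poisson_kernel r \<phi>)"
    by (intro integral_unique[symmetric] has_integral_mult_C1[OF G] cont')
      (auto simp: \<Phi>'_def intro: poisson_kernel_has_derivative[OF r])
  finally show ?thesis .
qed

text \<open>A nonempty bounded interval differs from \<open>[Inf I, Sup I]\<close> by at most its
  two endpoints, which are negligible; the empty one is covered by \<open>[0, 0]\<close>. So compact
  intervals suffice.\<close>

lemma alexiewicz_norm_le_iff:
  "alexiewicz_norm f \<le> B \<longleftrightarrow> (\<forall>a b. a \<le> b \<longrightarrow> b \<le> a + 2 * pi \<longrightarrow> ereal \<bar>integral {a..b} f\<bar> \<le> B)"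
    (is "_ \<longleftrightarrow> ?R")
proof
  assume "alexiewicz_norm f \<le> B"
  then show ?R
    unfolding alexiewicz_norm_def SUP_le_iff
    by (auto simp: is_interval_cc diameter_closed_interval)
next
  assume R: ?R
  show "alexiewicz_norm f \<le> B"
    unfolding alexiewicz_norm_def SUP_le_iff
  proof safe
    fix I :: "real set"
    assume I: "is_interval I" "bounded I" "diameter I \<le> 2 * pi"
    show "ereal \<bar>integral I f\<bar> \<le> B"
    proof (cases "I = {}")
      case True
      then show ?thesis using R[rule_format, of 0 0] by simp
    next
      case False
      have bdd: "bdd_above I" "bdd_below I"
        using I(2) by (auto intro: bounded_imp_bdd_above bounded_imp_bdd_below)
      have "y - 2 * pi \<le> x" if "x \<in> I" "y \<in> I" for x y
        using diameter_bounded_bound[OF I(2) that] I(3) by (simp add: dist_real_def)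
      then have "y - 2 * pi \<le> Inf I" if "y \<in> I" for y
        using that False by (intro cInf_greatest) auto
      then have "Sup I \<le> Inf I + 2 * pi"
        using False by (intro cSup_least) (auto simp: algebra_simps)
      moreover have sub: "I \<subseteq> {Inf I..Sup I}"
        using bdd by (auto intro: cInf_lower cSup_upper)
      moreover have "Inf I \<le> Sup I" using sub False by fastforce
      ultimately have le: "ereal \<bar>integral {Inf I..Sup I} f\<bar> \<le> B" using R by blast
      have gap: "{Inf I..Sup I} - I \<subseteq> {Inf I, Sup I}"
      proof
        fix x assume x: "x \<in> {Inf I..Sup I} - I"
        show "x \<in> {Inf I, Sup I}"
        proof (rule ccontr)
          assume "x \<notin> {Inf I, Sup I}"
          then have "Inf I < x" "x < Sup I" using x by auto
          then obtain y z where "y \<in> I" "y < x" "z \<in> I" "x < z"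
            using cInf_lessD[OF False] less_cSupD[OF False] by blast
          then have "x \<in> I" using I(1) unfolding is_interval_1 by (meson less_imp_le)
          then show False using x by simp
        qed
      qed
      have neg: "negligible {Inf I, Sup I}" by simp
      have "integral I f = integral {Inf I..Sup I} f"
      proof (rule integral_spike_set)
        show "negligible {x \<in> I - {Inf I..Sup I}. f x \<noteq> 0}"
          by (rule negligible_subset[OF neg]) (use sub in blast)
        show "negligible {x \<in> {Inf I..Sup I} - I. f x \<noteq> 0}"
          by (rule negligible_subset[OF neg]) (use gap in blast)
      qed
      with le show ?thesis by simp
    qed
  qed
qed

text \<open>For fixed length \<open>b - a\<close> the increment is periodic in \<open>a\<close>,
  since \<open>c\<close> cancels. Hence \<open>a\<close> may be moved into \<open>[-pi, pi]\<close>;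
  then \<open>b\<close> is at most \<open>3 * pi\<close> and compactness applies.\<close>

lemma quasiperiodic_increment_bounded:
  fixes F :: "real \<Rightarrow> real"
  assumes cont: "continuous_on UNIV F" and per: "\<And>x. F (x + 2 * pi) = F x + c"
  obtains M where "\<And>a b. a \<le> b \<Longrightarrow> b \<le> a + 2 * pi \<Longrightarrow> \<bar>F b - F a\<bar> \<le> M"
proof -
  have "compact (F ` {-pi..3 * pi})"
    by (intro compact_continuous_image continuous_on_subset[OF cont]) auto
  then obtain N where N: "\<And>x. x \<in> {-pi..3 * pi} \<Longrightarrow> \<bar>F x\<bar> \<le> N"
    using compact_imp_bounded bounded_real by (metis imageI)
  have "\<bar>F b - F a\<bar> \<le> 2 * N" if "a \<le> b" "b \<le> a + 2 * pi" for a b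
  proof -
    interpret periodic_fun_simple "\<lambda>x. F (x + (b - a)) - F x" "2 * pi"
      by unfold_locales (use per[of "_ + (b - a)"] per in \<open>simp add: algebra_simps\<close>)
    \<comment> \<open>The number of periods that carries \<open>a\<close> into
      \<open>[-pi, pi)\<close>.\<close>
    define n where "n = - \<lfloor>(a + pi) / (2 * pi)\<rfloor>"
    have "of_int (- n) \<le> (a + pi) / (2 * pi)" "(a + pi) / (2 * pi) < of_int (- n) + 1"
      by (simp_all add: n_def)
    then have "a + of_int n * (2 * pi) \<in> {-pi..pi}" by (auto simp: field_simps)
    then have "\<bar>F (a + of_int n * (2 * pi) + (b - a))\<bar> \<le> N" "\<bar>F (a + of_int n * (2 * pi))\<bar> \<le> N"
      using that by (auto intro!: N)
    then show ?thesis using plus_of_int[of a n] by simp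
  qed
  then show thesis by (rule that)
qed

lemma alexiewicz_norm_finite:
  assumes "f \<in> HK"
  shows "alexiewicz_norm f < \<infinity>"
proof -
  obtain F where F: "primitive_of f F" "\<And>x. F (x + 2 * pi) = F x + (F pi - F (-pi))"
    using HK_primitive[OF assms] by blast
  obtain M where "\<And>a b. a \<le> b \<Longrightarrow> b \<le> a + 2 * pi \<Longrightarrow> \<bar>F b - F a\<bar> \<le> M"
    using quasiperiodic_increment_bounded[OF primitive_of_continuous[OF F(1)] F(2)] by blast
  then have "alexiewicz_norm f \<le> ereal M"
    unfolding alexiewicz_norm_le_iff by (simp add: primitive_of_integral[OF F(1)])
  then show ?thesis by (rule order.strict_trans1) simp
qed

section \<open>The two inequalities of the isometry\<close>

lemma alexiewicz_norm_nonneg: "alexiewicz_norm f \<ge> 0"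
  using alexiewicz_norm_le_iff[of f "alexiewicz_norm f", THEN iffD1, rule_format, of 0 0]
  by (simp flip: zero_ereal_def)

text \<open>Each circle integral is an average, with the kernel as probability density, of integrals
  of \<open>f\<close> over translates of \<open>[a, b]\<close>.\<close>

lemma alexiewicz_norm_poisson_integral_le:
  assumes f: "f \<in> HK" and r: "0 \<le> r" "r < 1"
  shows "alexiewicz_norm (circle_fun (poisson_integral f) r) \<le> alexiewicz_norm f"
  unfolding alexiewicz_norm_le_iff
proof (intro allI impI)
  fix a b :: real assume ab: "a \<le> b" "b \<le> a + 2 * pi"
  obtain F where F: "primitive_of f F" "\<And>x. F (x + 2 * pi) = F x + (F pi - F (-pi))"
    using HK_primitive[OF f] by blast
  obtain N where N: "alexiewicz_norm f = ereal N"
    using alexiewicz_norm_finite[OF f] alexiewicz_norm_nonneg[of f] by (cases "alexiewicz_norm f") auto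
  have incr: "\<bar>F (t + b) - F (t + a)\<bar> \<le> N" for t
    using alexiewicz_norm_le_iff[of f "ereal N", THEN iffD1, rule_format, of "t + a" "t + b"] N ab
    by (simp add: primitive_of_integral[OF F(1)])
  note K = has_integral_poisson_kernel[OF r]
  have "norm (integral {-pi..pi} (\<lambda>t. (F (t + b) - F (t + a)) * poisson_kernel r t))
      \<le> integral {-pi..pi} (\<lambda>t. N * poisson_kernel r t)"
  proof (rule integral_norm_bound_integral)
    show "(\<lambda>t. (F (t + b) - F (t + a)) * poisson_kernel r t) integrable_on {-pi..pi}"
      by (intro integrable_continuous_interval continuous_intros continuous_on_poisson_kernel r
          primitive_of_continuous[OF primitive_of_shift[OF F(1)]])
    show "norm ((F (t + b) - F (t + a)) * poisson_kernel r t) \<le> N * poisson_kernel r t" for t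
      using incr[of t] poisson_kernel_pos[OF r, of t] by (simp add: abs_mult)
  qed (use has_integral_mult_right[OF K] in blast)
  also have "\<dots> = N" using integral_unique[OF has_integral_mult_right[OF K, of N]] by simp
  finally show "ereal \<bar>integral {a..b} (circle_fun (poisson_integral f) r)\<bar> \<le> alexiewicz_norm f"
    unfolding N integral_circle_fun_poisson_integral[OF f F r ab(1)] by simp
qed

text \<open>The approximate identity acts on the continuous function
  \<open>F (t + b) - F (t + a)\<close>, whose value at \<open>t = 0\<close> is the limit.\<close>

lemma integral_circle_fun_poisson_integral_tendsto:
  assumes f: "f \<in> HK" and F: "primitive_of f F" and "a \<le> b"
  shows "((\<lambda>r. integral {a..b} (circle_fun (poisson_integral f) r)) \<longlongrightarrow> F b - F a) (at_left 1)"
proof -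
  have per: "F (x + 2 * pi) = F x + (F pi - F (-pi))" for x
    using periodic_primitive_quasiperiodic[OF _ F] f by (simp add: HK_def)
  have "continuous_on {-pi..pi} (\<lambda>t. F (t + b) - F (t + a))"
    by (intro continuous_intros primitive_of_continuous[OF primitive_of_shift[OF F]])
  from poisson_kernel_approximate_identity[OF this]
  have "((\<lambda>r. integral {-pi..pi} (\<lambda>t. (F (t + b) - F (t + a)) * poisson_kernel r t)) \<longlongrightarrow> F b - F a) (at_left 1)"
    by simp
  moreover have "\<forall>\<^sub>F r in at_left 1. integral {-pi..pi} (\<lambda>t. (F (t + b) - F (t + a)) * poisson_kernel r t) =
      integral {a..b} (circle_fun (poisson_integral f) r)"
    by (rule eventually_at_leftI[of 0])
      (use integral_circle_fun_poisson_integral[OF f F per _ _ \<open>a \<le> b\<close>] in auto)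
  ultimately show ?thesis by (rule Lim_transform_eventually)
qed

text \<open>One inequality holds circle by circle. For the other, fix an interval: its circle
  integrals stay below the norm and converge to the integral of \<open>f\<close> as \<open>r\<close>
  tends to 1.\<close>

lemma hHK_norm_poisson_integral:
  assumes f: "f \<in> HK"
  shows "hHK_norm (poisson_integral f) = alexiewicz_norm f"
proof (rule antisym)
  show le: "hHK_norm (poisson_integral f) \<le> alexiewicz_norm f"
    unfolding hHK_norm_def by (intro SUP_least alexiewicz_norm_poisson_integral_le f) auto
  obtain F where F: "primitive_of f F" using HK_primitive[OF f] by blast
  have norm: "alexiewicz_norm (circle_fun (poisson_integral f) r) \<le> hHK_norm (poisson_integral f)"
    if "0 \<le> r" "r < 1" for r
    unfolding hHK_norm_def using that by (intro SUP_upper) auto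
  show "alexiewicz_norm f \<le> hHK_norm (poisson_integral f)"
    unfolding alexiewicz_norm_le_iff
  proof (intro allI impI)
    fix a b :: real assume ab: "a \<le> b" "b \<le> a + 2 * pi"
    have "((\<lambda>r. ereal \<bar>integral {a..b} (circle_fun (poisson_integral f) r)\<bar>) \<longlongrightarrow> ereal \<bar>F b - F a\<bar>) (at_left 1)"
      by (intro tendsto_intros integral_circle_fun_poisson_integral_tendsto f F ab)
    moreover have "\<forall>\<^sub>F r in at_left 1. ereal \<bar>integral {a..b} (circle_fun (poisson_integral f) r)\<bar>
        \<le> hHK_norm (poisson_integral f)"
      by (rule eventually_at_leftI[of 0]) (use norm ab in \<open>auto simp: alexiewicz_norm_le_iff\<close>)
    ultimately have "ereal \<bar>F b - F a\<bar> \<le> hHK_norm (poisson_integral f)"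
      by (rule tendsto_upperbound) simp
    then show "ereal \<bar>integral {a..b} f\<bar> \<le> hHK_norm (poisson_integral f)"
      using ab by (simp add: primitive_of_integral[OF F])
  qed
qed

subsection \<open>A harmonic function that is not a Poisson integral\<close>

text \<open>The Poisson integral of the Dirac measure at \<open>1\<close>.\<close>

definition dirac_poisson :: "complex \<Rightarrow> real" where
  "dirac_poisson z = poisson_kernel (cmod z) (Arg z)"

lemma dirac_poisson_eq_Re:
  assumes "z \<in> ball 0 1"
  shows "dirac_poisson z = Re ((1 + z) / (1 - z)) / (2 * pi)"
  using poisson_kernel_cmod_Arg[OF assms, of 0]
  by (simp add: dirac_poisson_def poisson_kernel_def)

lemma circle_fun_dirac_poisson:
  assumes "0 \<le> r" "r < 1"
  shows "circle_fun dirac_poisson r = poisson_kernel r"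
proof
  fix t
  show "circle_fun dirac_poisson r t = poisson_kernel r t"
    using poisson_kernel_eq_Re[OF assms, of 0 t] dirac_poisson_eq_Re[of "rcis r t"] assms
    by (simp add: circle_fun_def rcis_def norm_mult) (simp add: poisson_kernel_def)
qed

lemma dirac_poisson_in_hHK: "dirac_poisson \<in> hHK"
proof -
  have "harmonic_on (ball 0 1) dirac_poisson"
  proof (rule harmonic_on_Re_holomorphic)
    show "(\<lambda>z. (1 + z) / (1 - z) / of_real (2 * pi)) holomorphic_on ball 0 1"
      by (intro holomorphic_intros) auto
    show "dirac_poisson z = Re ((1 + z) / (1 - z) / of_real (2 * pi))" if "z \<in> ball 0 1" for z
      unfolding Re_divide_of_real by (rule dirac_poisson_eq_Re[OF that])
  qed simp
  moreover have "hHK_norm dirac_poisson \<le> 1"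
    unfolding hHK_norm_def
  proof (rule SUP_least)
    fix r :: real assume "r \<in> {0..<1}"
    then have r: "0 \<le> r" "r < 1" by auto
    note A = primitive_of_poisson_kernel[OF r]
    have mono: "poisson_primitive r a \<le> poisson_primitive r b" if "a \<le> b" for a b
      using has_integral_nonneg[OF primitive_ofD[OF A that]] less_imp_le[OF poisson_kernel_pos[OF r]]
      by simp
    \<comment> \<open>The primitive is nondecreasing and gains exactly 1 per period, so its
      increment lies between 0 and 1.\<close>
    have "\<bar>integral {a..b} (poisson_kernel r)\<bar> \<le> 1" if "a \<le> b" "b \<le> a + 2 * pi" for a b
      using mono[OF that(1)] mono[OF that(2)] by (simp add: primitive_of_integral[OF A that(1)] poisson_primitive_shift)
    then show "alexiewicz_norm (circle_fun dirac_poisson r) \<le> 1"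
      unfolding circle_fun_dirac_poisson[OF r] alexiewicz_norm_le_iff by (simp add: one_ereal_def)
  qed
  then have "hHK_norm dirac_poisson < \<infinity>" by (rule order.strict_trans1) simp
  ultimately show ?thesis by (simp add: hHK_def)
qed

text \<open>If the Dirac measure were represented by \<open>f\<close>, then the continuous primitive of \<open>f\<close> would
  increase by at least \<open>1 / 2\<close> over every interval \<open>[-\<delta>, \<delta>]\<close>.\<close>

lemma dirac_poisson_not_poisson_integral:
  assumes f: "f \<in> HK"
  shows "\<exists>z\<in>ball 0 1. dirac_poisson z \<noteq> poisson_integral f z"
proof (rule ccontr)
  assume "\<not> ?thesis"
  then have eq: "dirac_poisson z = poisson_integral f z" if "cmod z < 1" for z
    using that by auto
  obtain F where F: "primitive_of f F" using HK_primitive[OF f] by blast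
  have jump: "F d - F (-d) \<ge> 1 / 2" if d: "0 < d" "d < pi / 2" for d
  proof -
    have "\<forall>\<^sub>F r in at_left 1. integral {-d..d} (circle_fun (poisson_integral f) r)
        = poisson_primitive r d - poisson_primitive r (-d)"
    proof (rule eventually_at_leftI[of 0])
      fix r :: real assume "r \<in> {0<..<1}"
      then have r: "0 \<le> r" "r < 1" by auto
      have "circle_fun (poisson_integral f) r = circle_fun dirac_poisson r"
        using r by (auto simp: circle_fun_def fun_eq_iff norm_mult eq)
      then show "integral {-d..d} (circle_fun (poisson_integral f) r)
        = poisson_primitive r d - poisson_primitive r (-d)"
        using d by (simp add: circle_fun_dirac_poisson[OF r] primitive_of_integral[OF primitive_of_poisson_kernel[OF r]])
    qed simp
    with integral_circle_fun_poisson_integral_tendsto[OF f F, of "-d" d] d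
    have 1: "((\<lambda>r. poisson_primitive r d - poisson_primitive r (-d)) \<longlongrightarrow> F d - F (-d)) (at_left 1)"
      by (auto intro: Lim_transform_eventually)
    have sc: "sin d > 0" "cos d > 0" using d by (auto intro: sin_gt_zero cos_gt_zero)
    \<comment> \<open>Keeps the arctangent formula continuous in \<open>r\<close> up to
      \<open>r = 1\<close>, away from the singularity at angle \<open>0\<close>.\<close>
    have "1 - cos d > 0" using cos_monotone_0_pi[of 0 d] d by simp
    then have "((\<lambda>r. poisson_primitive r d - poisson_primitive r (-d)) \<longlongrightarrow>
        poisson_primitive 1 d - poisson_primitive 1 (-d)) (at_left 1)"
      unfolding poisson_primitive_def by (intro tendsto_intros) auto
    with 1 have "F d - F (-d) = poisson_primitive 1 d - poisson_primitive 1 (-d)"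
      using tendsto_unique[OF trivial_limit_at_left_real] by blast
    also have "\<dots> = (d + 2 * arctan (sin d / (1 - cos d))) / pi"
      by (simp add: poisson_primitive_def arctan_minus field_simps)
    \<comment> \<open>The quotient is \<open>cot (d / 2)\<close>, so the value is in fact 1. The
      cruder \<open>1 \<le> sin d + cos d\<close> makes the quotient at least 1, and
      \<open>arctan 1 = pi / 4\<close> yields \<open>1 / 2\<close>.\<close>
    also have "\<dots> \<ge> (0 + 2 * arctan 1) / pi"
    proof -
      have "1\<^sup>2 \<le> (sin d + cos d)\<^sup>2"
        using sc sin_cos_squared_add[of d] by (simp add: power2_sum)
      then have "1 \<le> sin d + cos d" using sc by (intro power2_le_imp_le[of 1]) auto
      then have "1 \<le> sin d / (1 - cos d)" using \<open>1 - cos d > 0\<close> by (simp add: field_simps)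
      then have "arctan 1 \<le> arctan (sin d / (1 - cos d))" by (rule arctan_monotone')
      then show ?thesis using d by (intro divide_right_mono add_mono mult_left_mono) auto
    qed
    finally show ?thesis by (simp add: arctan_one)
  qed
  \<comment> \<open>Continuity of \<open>F\<close> forces the symmetric increments to tend to 0,
    against the lower bound \<open>jump\<close>.\<close>
  have "continuous_on UNIV (\<lambda>d. F d - F (-d))"
    by (rule continuous_on_diff[OF primitive_of_continuous[OF F]
          continuous_on_compose2[OF primitive_of_continuous[OF F, of UNIV]]])
       (auto intro: continuous_intros)
  then have "((\<lambda>d. F d - F (-d)) \<longlongrightarrow> F 0 - F (-0)) (at 0)"
    unfolding continuous_on_def by blast
  then have "((\<lambda>d. F d - F (-d)) \<longlongrightarrow> 0) (at_right 0)"
    by (simp add: filterlim_at_split)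
  moreover have "\<forall>\<^sub>F d in at_right 0. 1 / 2 \<le> F d - F (-d)"
    by (rule eventually_at_rightI[of 0 "pi / 2"]) (use jump in auto)
  ultimately have "1 / 2 \<le> (0::real)"
    by (rule tendsto_lowerbound) simp
  then show False by simp
qed

theorem theorem8:
  shows "(\<forall>f\<in>HK. poisson_integral f \<in> hHK \<and> hHK_norm (poisson_integral f) = alexiewicz_norm f) \<and>
         (\<exists>v\<in>hHK. \<not> (\<exists>f\<in>HK. \<forall>z\<in>ball 0 1. v z = poisson_integral f z))"
proof (intro conjI ballI)
  fix f assume f: "f \<in> HK"
  show norm: "hHK_norm (poisson_integral f) = alexiewicz_norm f"
    by (rule hHK_norm_poisson_integral[OF f])
  show "poisson_integral f \<in> hHK"
    unfolding hHK_def using harmonic_on_poisson_integral[OF f] alexiewicz_norm_finite[OF f] norm by simp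
next
  show "\<exists>v\<in>hHK. \<not> (\<exists>f\<in>HK. \<forall>z\<in>ball 0 1. v z = poisson_integral f z)"
    using dirac_poisson_in_hHK dirac_poisson_not_poisson_integral by blast
qed

end
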